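(* Let $\mathcal{L}u=u_{xx}+u_{yy}-k^2u$, where $k$ is a real constant. Let $\Omega\subset\mathbb{R}^2$ be a domain with boundary $\partial\Omega$, and let $r$ be the radius of the smallest circle completely containing $\Omega$. Let $u$ be the solution to $\mathcal{L}u=f$ on $\Omega$ with $u|_{\partial\Omega}=g$, and let $s$ be the solution to $\mathcal{L}s=f+\epsilon$ on $\Omega$ with boundary conditions $s|_{\partial\Omega}=g$, where $\epsilon$ is a function on $\Omega$. Then $$\max|s-u|\le\frac{\max|\epsilon|\,r^2}{4}.$$
   Context: The domain $\Omega$ is bounded (it is contained in a disk of radius $r$). Solutions are classical: they belong to $\mathcal{C}^2(\Omega)\cap\mathcal{C}^0(\overline{\Omega})$ and take the prescribed boundary values on $\partial\Omega$. Here $\max|s-u|$ and $\max|\epsilon|$ denote the maximum (supremum) over $\Omega$ of the absolute values of the respective functions. *)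

theory Defs
  imports "HOL-Analysis.Analysis"
begin

definition partial_deriv :: "'n::finite \<Rightarrow> (real ^ 'n \<Rightarrow> real) \<Rightarrow> real ^ 'n \<Rightarrow> real" where
  "partial_deriv i u p = deriv (\<lambda>t. u (p + t *\<^sub>R axis i 1)) 0"

text \<open>
  Membership in \<open>C\<^sup>n(S)\<close>, for an open set \<open>S\<close>: all partial derivatives of order at most \<open>n\<close>
  exist and are continuous on \<open>S\<close>. Existence is stated explicitly because \<^const>\<open>deriv\<close> is total.
\<close>
primrec C_on :: "nat \<Rightarrow> (real ^ 'n::finite) set \<Rightarrow> (real ^ 'n \<Rightarrow> real) \<Rightarrow> bool" where
  "C_on 0 S u \<longleftrightarrow> continuous_on S u"
| "C_on (Suc n) S u \<longleftrightarrow> continuous_on S u \<and>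
     (\<forall>i. (\<forall>p\<in>S. (\<lambda>t. u (p + t *\<^sub>R axis i 1)) field_differentiable at 0) \<and>
          C_on n S (partial_deriv i u))"

definition helmholtz_op :: "real \<Rightarrow> (real ^ 2 \<Rightarrow> real) \<Rightarrow> real ^ 2 \<Rightarrow> real" where
  "helmholtz_op k u p =
     partial_deriv 1 (partial_deriv 1 u) p + partial_deriv 2 (partial_deriv 2 u) p - k\<^sup>2 * u p"

definition classical_solution ::
  "real \<Rightarrow> (real ^ 2) set \<Rightarrow> (real ^ 2 \<Rightarrow> real) \<Rightarrow> (real ^ 2 \<Rightarrow> real) \<Rightarrow> (real ^ 2 \<Rightarrow> real) \<Rightarrow> bool" where
  "classical_solution k \<Omega> f g u \<longleftrightarrow>
     C_on 2 \<Omega> u \<and> continuous_on (closure \<Omega>) u \<and>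
     (\<forall>p\<in>\<Omega>. helmholtz_op k u p = f p) \<and>
     (\<forall>p\<in>frontier \<Omega>. u p = g p)"

text \<open>
  The infimum is a minimum for bounded nonempty sets; see \<open>min_enclosing_radius_attained\<close> below.
\<close>
definition min_enclosing_radius :: "(real ^ 2) set \<Rightarrow> real" where
  "min_enclosing_radius S = Inf {\<rho>. \<exists>c. S \<subseteq> cball c \<rho>}"

text \<open>Extended-real valued, so that an unbounded function has supremum \<open>\<infinity>\<close>.\<close>
definition sup_abs :: "(real ^ 2) set \<Rightarrow> (real ^ 2 \<Rightarrow> real) \<Rightarrow> ereal" where
  "sup_abs S h = (SUP p\<in>S. ereal \<bar>h p\<bar>)"

lemma min_enclosing_radius_le:
  assumes "S \<noteq> {}" "S \<subseteq> cball c \<rho>"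
  shows "min_enclosing_radius S \<le> \<rho>"
  unfolding min_enclosing_radius_def
proof (rule cInf_lower)
  show "\<rho> \<in> {\<rho>. \<exists>c. S \<subseteq> cball c \<rho>}" using assms(2) by blast
  obtain x where "x \<in> S" using assms(1) by blast
  then show "bdd_below {\<rho>. \<exists>c. S \<subseteq> cball c \<rho>}"
    by (intro bdd_belowI[of _ 0]) (auto dest!: subsetD intro: order_trans[OF zero_le_dist])
qed

lemma min_enclosing_radius_attained:
  assumes "bounded S" "S \<noteq> {}"
  shows "\<exists>c. S \<subseteq> cball c (min_enclosing_radius S)"
proof -
  let ?R = "min_enclosing_radius S"
  define K where "K n = (\<Inter>x\<in>S. cball x (?R + inverse (real (Suc n))))" for n
  have "(\<Inter>n. K n) \<noteq> {}"
  proof (rule compact_nest)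
    fix n
    obtain x0 where "x0 \<in> S" using assms(2) by blast
    then have "K n = cball x0 (?R + inverse (real (Suc n))) \<inter> K n"
      by (auto simp: K_def)
    moreover have "closed (K n)" unfolding K_def by (intro closed_INT) auto
    ultimately show "compact (K n)" by (metis compact_Int_closed compact_cball)
    have ne: "{\<rho>. \<exists>c. S \<subseteq> cball c \<rho>} \<noteq> {}"
    proof -
      obtain c e where "\<And>x. x \<in> S \<Longrightarrow> dist c x \<le> e"
        using assms(1) unfolding bounded_def by blast
      then have "S \<subseteq> cball c e" by auto
      then show ?thesis by blast
    qed
    have "Inf {\<rho>. \<exists>c. S \<subseteq> cball c \<rho>} < ?R + inverse (real (Suc n))"
      by (simp add: min_enclosing_radius_def)
    from cInf_lessD[OF ne this] obtain \<rho> c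
      where "S \<subseteq> cball c \<rho>" "\<rho> < ?R + inverse (real (Suc n))" by blast
    then have "dist x c \<le> ?R + inverse (real (Suc n))" if "x \<in> S" for x
      using that by (metis dist_commute less_imp_le mem_cball order_trans subsetD)
    then have "c \<in> K n" unfolding K_def by auto
    then show "K n \<noteq> {}" by blast
  next
    fix m n :: nat assume "m \<le> n"
    then have "inverse (real (Suc n)) \<le> inverse (real (Suc m))" by simp
    then have "cball x (?R + inverse (real (Suc n))) \<subseteq> cball x (?R + inverse (real (Suc m)))" for x :: "real ^ 2"
      by (intro subset_cball) simp
    then show "K n \<subseteq> K m" unfolding K_def by blast
  qed
  then obtain c where c: "\<And>n. c \<in> K n" by blast
  have "dist c x \<le> ?R" if "x \<in> S" for x
  proof (rule LIMSEQ_le_const)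
    show "(\<lambda>n. ?R + inverse (real (Suc n))) \<longlonglongrightarrow> ?R"
      using tendsto_add[OF tendsto_const LIMSEQ_inverse_real_of_nat, of ?R] by simp
    show "\<exists>N. \<forall>n\<ge>N. dist c x \<le> ?R + inverse (real (Suc n))"
      using c that by (simp add: K_def dist_commute[of c x])
  qed
  then show ?thesis by (intro exI[of _ c]) auto
qed

end

theory Submission
  imports Defs
begin

text \<open>
  The estimate is a maximum principle with a quadratic barrier. Enclose \<open>\<Omega>\<close> in the disk of centre
  \<open>c\<close> and radius \<open>r\<close>, suppose \<open>\<bar>\<epsilon>\<bar> \<le> M\<close>, and put \<open>w = s - u\<close>, so that \<open>\<Delta>w = \<epsilon> + k\<^sup>2w\<close> in \<open>\<Omega>\<close> and
  \<open>w = 0\<close> on the boundary. For \<open>M' > M\<close> the barrier \<open>\<phi>(p) = M'/4 (r\<^sup>2 - \<bar>p - c\<bar>\<^sup>2)\<close> is nonnegative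
  on the closure of \<open>\<Omega>\<close> and satisfies \<open>\<Delta>\<phi> = -M'\<close>. If \<open>w - \<phi>\<close> were positive somewhere, its maximum
  over the compact closure would be attained at an interior point \<open>p\<close>. There \<open>\<Delta>(w - \<phi>) \<le> 0\<close>,
  that is, \<open>\<Delta>w \<le> -M'\<close>; but \<open>w(p) > \<phi>(p) \<ge> 0\<close> gives \<open>\<Delta>w = \<epsilon> + k\<^sup>2w \<ge> -M > -M'\<close>. Hence
  \<open>w \<le> \<phi> \<le> M'r\<^sup>2/4\<close>, and \<open>M'\<close> may decrease to \<open>M\<close>. The lower bound is the same statement with the
  roles of \<open>s\<close> and \<open>u\<close> exchanged.

  The strict inequality \<open>M' > M\<close> lets the second derivative test, applied along the two coordinate
  lines through \<open>p\<close> (\<open>second_partial_le_at_local_max\<close>), yield the contradiction in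
  \<open>helmholtz_upper_bound\<close>.
\<close>

lemma second_derivative_nonpos_at_local_max:
  fixes F F' :: "real \<Rightarrow> real"
  assumes F: "eventually (\<lambda>t. (F has_real_derivative F' t) (at t)) (nhds x)"
    and F': "(F' has_real_derivative D) (at x)"
    and max: "eventually (\<lambda>t. F t \<le> F x) (nhds x)"
  shows "D \<le> 0"
proof (rule ccontr)
  assume "\<not> D \<le> 0"
  obtain d where d: "d > 0" "\<And>t. dist t x < d \<Longrightarrow> (F has_real_derivative F' t) (at t) \<and> F t \<le> F x"
    using eventually_conj[OF F max] unfolding eventually_nhds_metric by blast
  have "F' x = 0"
    using d DERIV_local_max[of F "F' x" x d] by (auto simp: dist_real_def abs_minus_commute)
  obtain e where e: "e > 0" "\<And>h. 0 < h \<Longrightarrow> h < e \<Longrightarrow> F' x < F' (x + h)"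
    using DERIV_pos_inc_right[OF F'] \<open>\<not> D \<le> 0\<close> by auto
  define h where "h = min d e / 2"
  have h: "0 < h" "h < d" "h < e" using d(1) e(1) by (auto simp: h_def)
  have "F x < F (x + h)"
  proof (rule DERIV_pos_imp_increasing_open[of x "x + h" F])
    fix t assume t: "x < t" "t < x + h"
    then have "(F has_real_derivative F' t) (at t)" using d(2)[of t] h by (auto simp: dist_real_def)
    moreover have "F' t > 0" using e(2)[of "t - x"] t h \<open>F' x = 0\<close> by auto
    ultimately show "\<exists>y. (F has_real_derivative y) (at t) \<and> 0 < y" by blast
  next
    show "continuous_on {x..x + h} F"
    proof (intro continuous_at_imp_continuous_on ballI)
      fix t assume "t \<in> {x..x + h}"
      then show "isCont F t" using d(2)[of t] h by (auto simp: dist_real_def intro: DERIV_isCont)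
    qed
  qed (use h in auto)
  moreover have "F (x + h) \<le> F x" using d(2)[of "x + h"] h by (auto simp: dist_real_def)
  ultimately show False by simp
qed

text \<open>
  \<^const>\<open>partial_deriv\<close> only differentiates at parameter \<open>0\<close> of a line through the point in question;
  translating the base point gives the derivative at every parameter.
\<close>
lemma has_real_derivative_along_axis:
  assumes "(\<lambda>t. u (p + x *\<^sub>R axis i 1 + t *\<^sub>R axis i 1)) field_differentiable at 0"
  shows "((\<lambda>t. u (p + t *\<^sub>R axis i 1)) has_real_derivative
    partial_deriv i u (p + x *\<^sub>R axis i 1)) (at x)"
proof -
  have "((\<lambda>t. u (p + (t + x) *\<^sub>R axis i 1)) has_real_derivative
      partial_deriv i u (p + x *\<^sub>R axis i 1)) (at 0)"
    using assms unfolding partial_deriv_def DERIV_deriv_iff_field_differentiable[symmetric]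
    by (simp add: algebra_simps)
  then show ?thesis using DERIV_shift[of "\<lambda>t. u (p + t *\<^sub>R axis i 1)" _ 0 x] by simp
qed

lemma eventually_along_axis:
  fixes p :: "real ^ 'n::finite"
  assumes "eventually P (nhds p)"
  shows "eventually (\<lambda>t. P (p + t *\<^sub>R axis i 1)) (nhds (0::real))"
proof -
  have "isCont (\<lambda>t::real. p + t *\<^sub>R axis i 1) 0" by (intro continuous_intros)
  then have "filterlim (\<lambda>t::real. p + t *\<^sub>R axis i 1) (nhds p) (nhds 0)"
    using tendsto_at_iff_tendsto_nhds[of "\<lambda>t::real. p + t *\<^sub>R axis i 1" 0]
    by (simp add: continuous_at)
  then show ?thesis using assms by (rule eventually_compose_filterlim[rotated])
qed

text \<open>
  The quadratic term is the negative of a barrier up to a constant; its second derivative along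
  every axis is \<open>2 * a\<close>.
\<close>
lemma second_partial_le_at_local_max:
  fixes u s :: "real ^ 'n::finite \<Rightarrow> real"
  assumes "open S" "p \<in> S" and u: "C_on 2 S u" and s: "C_on 2 S s"
    and max: "eventually (\<lambda>q. s q - u q + a * (norm (q - c))\<^sup>2 \<le> s p - u p + a * (norm (p - c))\<^sup>2) (nhds p)"
  shows "partial_deriv i (partial_deriv i s) p + 2 * a \<le> partial_deriv i (partial_deriv i u) p"
proof -
  define L where "L t = p + t *\<^sub>R axis i 1" for t :: real
  have first: "((\<lambda>t. v (L t)) has_real_derivative partial_deriv i v (L t)) (at t)"
    if "C_on 2 S v" "L t \<in> S" for v t
    using that has_real_derivative_along_axis[of v p t i] by (auto simp: L_def numeral_2_eq_2)
  have second: "((\<lambda>t. partial_deriv i v (L t)) has_real_derivative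
      partial_deriv i (partial_deriv i v) p) (at 0)" if "C_on 2 S v" for v
    using that \<open>p \<in> S\<close> has_real_derivative_along_axis[of "partial_deriv i v" p 0 i]
    by (auto simp: L_def numeral_2_eq_2)
  have quad: "(norm (L t - c))\<^sup>2 = (norm (p - c))\<^sup>2 + 2 * t * (p - c) $ i + t\<^sup>2" for t
  proof -
    have "L t - c = (p - c) + t *\<^sub>R axis i 1" by (simp add: L_def)
    then have "(norm (L t - c))\<^sup>2 = (p - c + t *\<^sub>R axis i 1) \<bullet> (p - c + t *\<^sub>R axis i 1)"
      by (simp only: power2_norm_eq_inner)
    also have "\<dots> = (p - c) \<bullet> (p - c) + 2 * t * ((p - c) \<bullet> axis i 1) + t\<^sup>2 * (axis i 1 \<bullet> axis i (1::real))"
      by (simp only: inner_add_left inner_add_right inner_scaleR_left inner_scaleR_right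
          inner_commute[of "axis i 1" "p - c"] power2_eq_square) (simp add: algebra_simps)
    finally show ?thesis by (simp add: inner_axis axis_nth power2_norm_eq_inner)
  qed
  define F where "F t = s (L t) - u (L t) + a * ((norm (p - c))\<^sup>2 + 2 * t * (p - c) $ i + t\<^sup>2)" for t
  define F' where "F' t = partial_deriv i s (L t) - partial_deriv i u (L t)
    + a * (2 * (p - c) $ i + 2 * t)" for t
  have "eventually (\<lambda>t. L t \<in> S) (nhds 0)"
    unfolding L_def using assms(1,2) by (intro eventually_along_axis eventually_nhds_in_open)
  then have "eventually (\<lambda>t. (F has_real_derivative F' t) (at t)) (nhds 0)"
  proof eventually_elim
    case (elim t)
    show ?case unfolding F_def F'_def
      by (rule derivative_eq_intros first[OF u elim] first[OF s elim] refl | simp)+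
  qed
  moreover have "(F' has_real_derivative
      partial_deriv i (partial_deriv i s) p - partial_deriv i (partial_deriv i u) p + a * 2) (at 0)"
    unfolding F'_def by (rule derivative_eq_intros second[OF u] second[OF s] refl | simp)+
  moreover have "eventually (\<lambda>t. F t \<le> F 0) (nhds 0)"
    using eventually_along_axis[OF max, of i] unfolding F_def quad[symmetric] by (simp add: L_def)
  ultimately show ?thesis using second_derivative_nonpos_at_local_max by fastforce
qed

text \<open>
  Both solutions enter as hypotheses, instead of their difference, so that exchanging them gives
  the lower bound on \<open>s - u\<close>. The term \<open>-k\<^sup>2u\<close> has the favourable sign: at a point where \<open>s > u\<close> it
  can only increase the Laplacian of \<open>s - u\<close>.
\<close>
lemma helmholtz_upper_bound:
  assumes "open \<Omega>" and \<Omega>: "\<Omega> \<subseteq> cball c r"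
    and u: "classical_solution k \<Omega> f g u" and s: "classical_solution k \<Omega> f' g s"
    and "0 \<le> M" and f: "\<And>p. p \<in> \<Omega> \<Longrightarrow> f p \<le> f' p + M"
    and "p \<in> \<Omega>"
  shows "s p - u p \<le> M * r\<^sup>2 / 4"
proof (rule field_le_epsilon)
  fix e :: real assume "e > 0"
  have clos: "closure \<Omega> \<subseteq> cball c r" using \<Omega> by (simp add: closure_minimal)
  then have r: "(norm (q - c))\<^sup>2 \<le> r\<^sup>2" if "q \<in> closure \<Omega>" for q
    using that by (intro power_mono) (auto simp: dist_norm norm_minus_commute)
  \<comment> \<open>An excess of at most \<open>4 e / r\<^sup>2\<close> over \<open>M\<close> suffices; the denominator is shifted away from \<open>0\<close>.\<close>
  define M' where "M' = M + 4 * e / (r\<^sup>2 + 1)"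
  have pos: "r\<^sup>2 + 1 > 0" by (simp add: add_nonneg_pos)
  have M': "M < M'" using \<open>e > 0\<close> pos by (simp add: M'_def)
  define h where "h q = s q - u q + M' / 4 * (norm (q - c))\<^sup>2" for q
  have "compact (closure \<Omega>)" using \<Omega> bounded_subset[OF bounded_cball] by (simp add: compact_closure)
  moreover have "continuous_on (closure \<Omega>) h"
    using u s unfolding h_def classical_solution_def by (intro continuous_intros) auto
  ultimately obtain q where q: "q \<in> closure \<Omega>" "\<And>x. x \<in> closure \<Omega> \<Longrightarrow> h x \<le> h q"
    using continuous_attains_sup[of "closure \<Omega>" h] \<open>p \<in> \<Omega>\<close> by (metis closure_eq_empty empty_iff)
  have hq: "h q \<le> M' / 4 * r\<^sup>2"
  proof (rule ccontr)
    assume large: "\<not> ?thesis"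
    have "M' / 4 * (norm (q - c))\<^sup>2 \<le> M' / 4 * r\<^sup>2"
      using r[OF q(1)] M' \<open>0 \<le> M\<close> by (intro mult_left_mono) auto
    with large have wpos: "s q - u q > 0" by (simp add: h_def)
    then have "q \<notin> frontier \<Omega>" using u s by (auto simp: classical_solution_def)
    then have "q \<in> \<Omega>" using q(1) \<open>open \<Omega>\<close> by (simp add: frontier_def interior_open)
    have "eventually (\<lambda>x. x \<in> \<Omega>) (nhds q)"
      using \<open>open \<Omega>\<close> \<open>q \<in> \<Omega>\<close> by (rule eventually_nhds_in_open)
    then have "eventually (\<lambda>x. h x \<le> h q) (nhds q)"
      by eventually_elim (use q(2) closure_subset in blast)
    then have "partial_deriv i (partial_deriv i s) q + 2 * (M' / 4)
        \<le> partial_deriv i (partial_deriv i u) q" for i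
      using u s \<open>open \<Omega>\<close> \<open>q \<in> \<Omega>\<close> unfolding h_def classical_solution_def
      by (intro second_partial_le_at_local_max) auto
    from this[of 1] this[of 2]
    have "helmholtz_op k s q + k\<^sup>2 * (s q - u q) + M' \<le> helmholtz_op k u q"
      by (simp add: helmholtz_op_def algebra_simps)
    moreover have "k\<^sup>2 * (s q - u q) \<ge> 0" using wpos by simp
    ultimately have "f' q + M' \<le> f q" using u s \<open>q \<in> \<Omega>\<close> by (auto simp: classical_solution_def)
    with f[OF \<open>q \<in> \<Omega>\<close>] M' show False by simp
  qed
  have "s p - u p \<le> h p" using M' \<open>0 \<le> M\<close> by (simp add: h_def)
  also have "\<dots> \<le> M' / 4 * r\<^sup>2" using q(2) hq \<open>p \<in> \<Omega>\<close> closure_subset by fastforce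
  also have "\<dots> = M * r\<^sup>2 / 4 + e * (r\<^sup>2 / (r\<^sup>2 + 1))" by (simp add: M'_def field_simps)
  also have "\<dots> \<le> M * r\<^sup>2 / 4 + e"
    using \<open>e > 0\<close> pos by (intro add_left_mono) (simp add: mult_le_cancel_left1 divide_le_eq)
  finally show "s p - u p \<le> M * r\<^sup>2 / 4 + e" .
qed

theorem theorem2p5:
  fixes k r :: real and \<Omega> :: "(real ^ 2) set" and u s f g \<epsilon> :: "real ^ 2 \<Rightarrow> real"
  assumes "open \<Omega>" and "connected \<Omega>" and "\<Omega> \<noteq> {}" and "bounded \<Omega>"
    and "r = min_enclosing_radius \<Omega>"
    and "classical_solution k \<Omega> f g u"
    and "classical_solution k \<Omega> (\<lambda>p. f p + \<epsilon> p) g s"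
  shows "sup_abs \<Omega> (\<lambda>p. s p - u p) \<le> sup_abs \<Omega> \<epsilon> * ereal (r\<^sup>2) / 4"
proof -
  obtain c where c: "\<Omega> \<subseteq> cball c r"
    using min_enclosing_radius_attained assms by blast
  \<comment> \<open>Since \<open>\<infinity> * 0 = 0\<close> for extended reals, the case of unbounded \<open>\<epsilon>\<close> needs a positive radius.\<close>
  have "r > 0"
  proof (rule ccontr)
    assume "\<not> r > 0"
    then have "cball c r \<subseteq> {c}"
      by (intro subsetI) (metis dist_le_zero_iff insertI1 linorder_not_less mem_cball order_trans)
    then have "\<Omega> = {c}" using c \<open>\<Omega> \<noteq> {}\<close> by blast
    then show False using \<open>open \<Omega>\<close> not_open_singleton by blast
  qed
  have bound: "ereal \<bar>\<epsilon> p\<bar> \<le> sup_abs \<Omega> \<epsilon>" if "p \<in> \<Omega>" for p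
    using that unfolding sup_abs_def by (intro SUP_upper)
  obtain p0 where "p0 \<in> \<Omega>" using \<open>\<Omega> \<noteq> {}\<close> by blast
  have "0 \<le> sup_abs \<Omega> \<epsilon>" using bound[OF \<open>p0 \<in> \<Omega>\<close>] by (rule order_trans[rotated]) simp
  then consider "sup_abs \<Omega> \<epsilon> = \<infinity>" | M where "sup_abs \<Omega> \<epsilon> = ereal M" "0 \<le> M"
    by (cases "sup_abs \<Omega> \<epsilon>") auto
  then show ?thesis
  proof cases
    case 1
    then show ?thesis using \<open>r > 0\<close> by simp
  next
    case 2
    have \<epsilon>: "\<bar>\<epsilon> p\<bar> \<le> M" if "p \<in> \<Omega>" for p using bound[OF that] 2 by simp
    have "\<bar>s p - u p\<bar> \<le> M * r\<^sup>2 / 4" if "p \<in> \<Omega>" for p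
    proof -
      have "s p - u p \<le> M * r\<^sup>2 / 4"
        using \<epsilon> by (intro helmholtz_upper_bound[OF assms(1) c assms(6,7) \<open>0 \<le> M\<close> _ that]) fastforce
      moreover have "u p - s p \<le> M * r\<^sup>2 / 4"
        using \<epsilon> by (intro helmholtz_upper_bound[OF assms(1) c assms(7,6) \<open>0 \<le> M\<close> _ that]) fastforce
      ultimately show ?thesis by linarith
    qed
    then show ?thesis unfolding 2 unfolding sup_abs_def by (intro SUP_least) simp
  qed
qed

end
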